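(* Let $S:\mathbb{R}^n\rightrightarrows\mathbb{R}^m$ be a set-valued mapping, let $X\subseteq\mathbb{R}^n$ be closed, $\bar{x}\in X$, and $\bar{u}\in S(\bar{x})$. Suppose that $\operatorname{gph}S$ is locally closed at $(\bar{x},\bar{u})$, and that $X$ is a smooth manifold around $\bar{x}$ with $X\subseteq\operatorname{dom}S$. Then the mapping $(x,u)\mapsto\operatorname{proj}_{T_X(x)\times\mathbb{R}^m}N_{\operatorname{gph}S|_X}(x,u)$ is outer semicontinuous relative to $\operatorname{gph}S|_X$ at $(\bar{x},\bar{u})$, and $$D^*_XS(\bar{x}\mid\bar{u})=\operatorname*{g-limsup}_{(x,u)\to(\bar{x},\bar{u}),\,(x,u)\in\operatorname{gph}S|_X}D^*_XS(x\mid u)=\operatorname{proj}_{T_X(\bar{x})}D^*S|_X(\bar{x}\mid\bar{u}).$$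
   Context: For $C\subseteq\mathbb{R}^n$ and $x\in C$: $T_C(x)=\limsup_{t\searrow 0}\frac{C-x}{t}$ (outer limit) is the tangent (contingent) cone; the regular normal cone is $\widehat{N}_C(x)=\{v\mid \limsup_{x'\to x,\,x'\in C,\,x'\neq x}\langle v,x'-x\rangle/\|x'-x\|\le 0\}$; the limiting normal cone $N_C(x)$ is the set of $v$ for which there are $x_k\to x$, $x_k\in C$, and $v_k\to v$ with $v_k\in\widehat{N}_C(x_k)$. These are empty for $x\notin C$. $C$ is locally closed at $x\in C$ if $C\cap U$ is closed for some closed neighborhood $U$ of $x$. $\operatorname{proj}_C(x)=\{y\in C\mid\|y-x\|=d(x,C)\}$ and $\operatorname{proj}_CA=\bigcup_{a\in A}\operatorname{proj}_C(a)$; for a mapping $H$, $\operatorname{proj}_CH$ is the mapping $u^*\mapsto\operatorname{proj}_C(H(u^* ))$. For $S:\mathbb{R}^n\rightrightarrows\mathbb{R}^m$, $\operatorname{gph}S=\{(x,u)\mid u\in S(x)\}$, $\operatorname{dom}S=\{x\mid S(x)\ne\emptyset\}$; $S|_X$ equals $S(x)$ for $x\in X$ and $\emptyset$ for $x\notin X$. The coderivative is defined by $x^*\in D^*S(\bar{x}\mid\bar{u})(u^* )\iff(x^*,-u^* )\in N_{\operatorname{gph}S}(\bar{x},\bar{u})$. The projectional coderivative $D^*_XS(\bar{x}\mid\bar{u}):\mathbb{R}^m\rightrightarrows\mathbb{R}^n$ (for $\bar{x}\in X$, $\bar{u}\in S(\bar{x})$) is defined by $$t^*\in D^*_XS(\bar{x}\mid\bar{u})(u^*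 )\iff(t^*,-u^* )\in\limsup_{(x,u)\to(\bar{x},\bar{u}),\,(x,u)\in\operatorname{gph}S|_X}\operatorname{proj}_{T_X(x)\times\mathbb{R}^m}N_{\operatorname{gph}S|_X}(x,u),$$ with $\limsup$ the (Painlevé–Kuratowski) outer limit of sets. A mapping $M$ is outer semicontinuous at $\bar{z}$ relative to $Z$ if $\bar{z}\in Z$ and $\limsup_{z\to\bar{z},\,z\in Z}M(z)=M(\bar{z})$. The graphical outer limit $\operatorname{g-limsup}$ of a family of mappings is the mapping whose graph is the outer limit of their graphs. $X$ is a ($d$-dimensional) smooth manifold around $\bar{x}\in X$ if there are an open neighborhood $O$ of $\bar{x}$ and a $\mathcal{C}^1$ mapping $F:O\to\mathbb{R}^{n-d}$ with $\nabla F(\bar{x})$ of full rank $n-d$ such that $X\cap O=\{x\in O\mid F(x)=0\}$. *)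

theory Defs
  imports "HOL-Analysis.Analysis"
begin

section \<open>Outer limits\<close>

text \<open>The filter for \<open>z \<rightarrow> x\<close> with \<open>z \<in> A\<close>. Unlike \<^term>\<open>at x within A\<close> it does not exclude
  \<open>z = x\<close>; this is the standard convention for outer limits of sets.\<close>

definition nhds_in :: "'a::topological_space \<Rightarrow> 'a set \<Rightarrow> 'a filter" where
  "nhds_in x A = inf (nhds x) (principal A)"

text \<open>Painleve-Kuratowski outer limit of the sets \<open>A z\<close> along the filter \<open>F\<close>.\<close>

definition outer_limit :: "'i filter \<Rightarrow> ('i \<Rightarrow> 'a::topological_space set) \<Rightarrow> 'a set" where
  "outer_limit F A =
     {y. \<exists>z w. filterlim z F sequentially \<and> (\<forall>k. w k \<in> A (z k)) \<and> w \<longlonglongrightarrow> y}"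

definition osc_relative_at ::
  "('a::topological_space \<Rightarrow> 'b::topological_space set) \<Rightarrow> 'a set \<Rightarrow> 'a \<Rightarrow> bool" where
  "osc_relative_at M Z z \<longleftrightarrow> z \<in> Z \<and> outer_limit (nhds_in z Z) M = M z"


section \<open>Set-valued mappings\<close>

definition gph :: "('a \<Rightarrow> 'b set) \<Rightarrow> ('a \<times> 'b) set" where
  "gph S = {(x, u). u \<in> S x}"

definition sv_dom :: "('a \<Rightarrow> 'b set) \<Rightarrow> 'a set" where
  "sv_dom S = {x. S x \<noteq> {}}"

definition sv_restrict :: "('a \<Rightarrow> 'b set) \<Rightarrow> 'a set \<Rightarrow> 'a \<Rightarrow> 'b set" where
  "sv_restrict S X = (\<lambda>x. if x \<in> X then S x else {})"

definition graphical_outer_limit ::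
  "'i filter \<Rightarrow> ('i \<Rightarrow> 'a::topological_space \<Rightarrow> 'b::topological_space set) \<Rightarrow> 'a \<Rightarrow> 'b set" where
  "graphical_outer_limit F M = (\<lambda>a. {b. (a, b) \<in> outer_limit F (\<lambda>z. gph (M z))})"


section \<open>Projections\<close>

definition proj_point :: "'a::euclidean_space set \<Rightarrow> 'a \<Rightarrow> 'a set" where
  "proj_point C x = {y \<in> C. norm (y - x) = infdist x C}"

definition proj_set :: "'a::euclidean_space set \<Rightarrow> 'a set \<Rightarrow> 'a set" where
  "proj_set C A = (\<Union>a\<in>A. proj_point C a)"

definition proj_map :: "'a::euclidean_space set \<Rightarrow> ('b \<Rightarrow> 'a set) \<Rightarrow> 'b \<Rightarrow> 'a set" where
  "proj_map C H = (\<lambda>u. proj_set C (H u))"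


section \<open>Tangent and normal cones\<close>

definition tangent_cone :: "'a::euclidean_space set \<Rightarrow> 'a \<Rightarrow> 'a set" where
  "tangent_cone C x =
     (if x \<in> C then outer_limit (at_right 0) (\<lambda>t::real. (\<lambda>c. (c - x) /\<^sub>R t) ` C) else {})"

text \<open>If \<open>x\<close> is isolated in \<open>C\<close> then \<^term>\<open>at x within C\<close> is the trivial filter, the upper limit
  is \<open>-\<infinity>\<close>, and the cone is the whole space, as it should be.\<close>

definition regular_normal_cone :: "'a::euclidean_space set \<Rightarrow> 'a \<Rightarrow> 'a set" where
  "regular_normal_cone C x =
     (if x \<in> C
      then {v. Limsup (at x within C) (\<lambda>x'. ereal (v \<bullet> (x' - x) / norm (x' - x))) \<le> 0}
      else {})"

definition normal_cone :: "'a::euclidean_space set \<Rightarrow> 'a \<Rightarrow> 'a set" where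
  "normal_cone C x =
     (if x \<in> C then outer_limit (nhds_in x C) (regular_normal_cone C) else {})"

definition locally_closed_at :: "'a::topological_space set \<Rightarrow> 'a \<Rightarrow> bool" where
  "locally_closed_at C x \<longleftrightarrow>
     x \<in> C \<and> (\<exists>U. closed U \<and> x \<in> interior U \<and> closed (C \<inter> U))"


section \<open>Coderivatives\<close>

definition coderivative ::
  "('a::euclidean_space \<Rightarrow> 'b::euclidean_space set) \<Rightarrow> 'a \<Rightarrow> 'b \<Rightarrow> 'b \<Rightarrow> 'a set" where
  "coderivative S x u = (\<lambda>u'. {x'. (x', - u') \<in> normal_cone (gph S) (x, u)})"

definition projected_normals ::
  "'a::euclidean_space set \<Rightarrow> ('a \<Rightarrow> 'b::euclidean_space set) \<Rightarrow> 'a \<times> 'b \<Rightarrow> ('a \<times> 'b) set" where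
  "projected_normals X S =
     (\<lambda>(x, u). proj_set (tangent_cone X x \<times> UNIV) (normal_cone (gph (sv_restrict S X)) (x, u)))"

text \<open>Meaningful for \<open>x \<in> X\<close> and \<open>u \<in> S x\<close>.\<close>

definition proj_coderivative ::
  "'a::euclidean_space set \<Rightarrow> ('a \<Rightarrow> 'b::euclidean_space set) \<Rightarrow> 'a \<Rightarrow> 'b \<Rightarrow> 'b \<Rightarrow> 'a set" where
  "proj_coderivative X S x u =
     (\<lambda>u'. {t. (t, - u') \<in>
        outer_limit (nhds_in (x, u) (gph (sv_restrict S X))) (projected_normals X S)})"


section \<open>Smooth manifolds\<close>

text \<open>The codomain of the defining map has dimension \<open>n - d\<close>, which may be 0, so the map is given
  by its component functions \<open>F i\<close> for \<open>i < n - d\<close>. The gradients \<open>G i x\<close> are the rows of its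
  Jacobian at \<open>x\<close>; the last condition says that the Jacobian at \<open>x0\<close> has rank \<open>n - d\<close>.\<close>

definition smooth_manifold_around :: "'a::euclidean_space set \<Rightarrow> 'a \<Rightarrow> bool" where
  "smooth_manifold_around X x0 \<longleftrightarrow>
     x0 \<in> X \<and>
     (\<exists>d \<le> DIM('a). \<exists>U (F :: nat \<Rightarrow> 'a \<Rightarrow> real) G.
        open U \<and> x0 \<in> U \<and>
        (\<forall>i < DIM('a) - d. (\<forall>x\<in>U. GDERIV (F i) x :> G i x) \<and> continuous_on U (G i)) \<and>
        X \<inter> U = {x \<in> U. \<forall>i < DIM('a) - d. F i x = 0} \<and>
        dim ((\<lambda>i. G i x0) ` {..< DIM('a) - d}) = DIM('a) - d)"

end

theory Submission
  imports Defs
begin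

text \<open>
  Let \<open>C\<close> be the graph of the restriction of \<open>S\<close> to \<open>X\<close>. Since \<open>C\<close> lies over \<open>X\<close>, a vector
  \<open>g\<close> that is normal to \<open>X\<close> at \<open>x\<close> gives a normal \<open>(g, 0)\<close> to \<open>C\<close> at \<open>(x, u)\<close>, and
  regular normals may be added. On a smooth manifold the normal vectors at \<open>x\<close> are the linear
  combinations of the constraint gradients at \<open>x\<close>; they are regular and vary continuously
  with \<open>x\<close>. Hence the limiting normal cone of \<open>C\<close>, too, is invariant under translation by
  \<open>(g, 0)\<close> (\<open>normal_cone_add_cylinder\<close>). The tangent cone of \<open>X\<close> at \<open>x\<close> is the orthogonal
  complement of the normal space, so that projecting a normal of \<open>C\<close> onto the product of the
  tangent cone and the whole space subtracts such a vector \<open>(g, 0)\<close>, and the result is again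
  a normal of \<open>C\<close>. The projected normals are thus simply those normals of \<open>C\<close> whose first
  component is orthogonal to the gradients (\<open>proj_set_normal_cone_over_manifold\<close>). Both
  conditions persist in the limit: the limiting normal cone is an outer limit, hence outer
  semicontinuous, and the gradients are continuous. This is the asserted outer semicontinuity
  (\<open>osc_projected_normals\<close>).

  The two equations follow. By outer semicontinuity the outer limit in the definition of the
  projectional coderivative is the set of projected normals at the base point itself, and the
  projection onto the cylinder acts on the first component only. The graphical outer limit
  changes nothing, because an outer limit of outer limits of the same family is again its outer
  limit, by a diagonal argument.

  The analytic input is that near the base point the tangent cone of \<open>X\<close> is the whole kernel
  of the gradients. The inverse function theorem supplies a chart in which \<open>X\<close> becomes a linear
  subspace, and lines in this subspace become curves in \<open>X\<close> with prescribed velocity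
  (\<open>smooth_manifold_straightening\<close>).
\<close>

section \<open>Outer limits along points of a set\<close>

text \<open>In metric spaces the sequences in an outer limit can be traded for balls, which turns diagonal
  sequence arguments into the triangle inequality.\<close>

lemma outer_limit_nhds_in_iff:
  fixes x :: "'a::metric_space" and M :: "'a \<Rightarrow> 'b::metric_space set"
  shows "y \<in> outer_limit (nhds_in x A) M \<longleftrightarrow>
    (\<forall>e>0. \<exists>z\<in>A. \<exists>w\<in>M z. dist z x < e \<and> dist w y < e)"
proof
  assume "y \<in> outer_limit (nhds_in x A) M"
  then obtain z w where z: "filterlim z (nhds_in x A) sequentially"
    and w: "\<And>k. w k \<in> M (z k)" "w \<longlonglongrightarrow> y"
    by (auto simp: outer_limit_def)
  show "\<forall>e>0. \<exists>z\<in>A. \<exists>w\<in>M z. dist z x < e \<and> dist w y < e"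
  proof (intro allI impI)
    fix e :: real assume "e > 0"
    have "z \<longlonglongrightarrow> x" and zA: "\<forall>\<^sub>F k in sequentially. z k \<in> A"
      using z by (auto simp: nhds_in_def filterlim_inf filterlim_principal)
    with \<open>e > 0\<close> w(2) have "\<forall>\<^sub>F k in sequentially. z k \<in> A \<and> dist (z k) x < e \<and> dist (w k) y < e"
      by (auto intro!: eventually_conj dest: tendstoD)
    then obtain k where "z k \<in> A \<and> dist (z k) x < e \<and> dist (w k) y < e"
      using eventually_happens trivial_limit_sequentially by blast
    then show "\<exists>z\<in>A. \<exists>w\<in>M z. dist z x < e \<and> dist w y < e"
      using w(1) by blast
  qed
next
  assume *: "\<forall>e>0. \<exists>z\<in>A. \<exists>w\<in>M z. dist z x < e \<and> dist w y < e"
  have "\<exists>z w. z \<in> A \<and> w \<in> M z \<and> dist z x < inverse (real (Suc k)) \<and>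
      dist w y < inverse (real (Suc k))" for k
    using *[rule_format, of "inverse (real (Suc k))"] by auto
  then obtain z w where zw: "\<And>k. z k \<in> A" "\<And>k. w k \<in> M (z k)"
    "\<And>k. dist (z k) x < inverse (real (Suc k))" "\<And>k. dist (w k) y < inverse (real (Suc k))"
    by metis
  have "z \<longlonglongrightarrow> x" "w \<longlonglongrightarrow> y"
    by (rule metric_tendsto_imp_tendsto[OF LIMSEQ_inverse_real_of_nat],
        use zw(3,4) in \<open>auto intro!: always_eventually less_imp_le\<close>)+
  then show "y \<in> outer_limit (nhds_in x A) M"
    unfolding outer_limit_def nhds_in_def filterlim_inf filterlim_principal using zw(1,2)
    by (intro CollectI exI[of _ z] exI[of _ w]) auto
qed

lemma subset_outer_limit_nhds_in:
  fixes M :: "'a::metric_space \<Rightarrow> 'b::metric_space set"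
  assumes "z \<in> A"
  shows "M z \<subseteq> outer_limit (nhds_in z A) M"
  using assms by (force simp: outer_limit_nhds_in_iff)

text \<open>Applied to regular normals this gives the outer semicontinuity of the limiting normal cone,
  applied to projected normals the stability of the projectional coderivative.\<close>

lemma outer_limit_nhds_in_idem:
  fixes M :: "'a::metric_space \<Rightarrow> 'b::metric_space set"
  assumes L: "\<And>z. z \<in> A \<Longrightarrow> L z = outer_limit (nhds_in z A) M"
  shows "outer_limit (nhds_in x A) L = outer_limit (nhds_in x A) M"
proof (intro set_eqI iffI)
  fix y assume y: "y \<in> outer_limit (nhds_in x A) L"
  show "y \<in> outer_limit (nhds_in x A) M"
    unfolding outer_limit_nhds_in_iff
  proof (intro allI impI)
    fix e :: real assume "e > 0"
    then obtain z w where zw: "z \<in> A" "w \<in> L z" "dist z x < e/2" "dist w y < e/2"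
      using y unfolding outer_limit_nhds_in_iff by (meson half_gt_zero)
    then obtain z' w' where zw': "z' \<in> A" "w' \<in> M z'" "dist z' z < e/2" "dist w' w < e/2"
      using \<open>e > 0\<close> unfolding L[OF zw(1)] outer_limit_nhds_in_iff by (meson half_gt_zero)
    have "dist z' x < e" "dist w' y < e"
      using zw(3,4) zw'(3,4) dist_triangle_half_r dist_commute by metis+
    with zw' show "\<exists>z\<in>A. \<exists>w\<in>M z. dist z x < e \<and> dist w y < e" by blast
  qed
next
  fix y assume "y \<in> outer_limit (nhds_in x A) M"
  then show "y \<in> outer_limit (nhds_in x A) L"
    using subset_outer_limit_nhds_in[of _ A M] L unfolding outer_limit_nhds_in_iff by blast
qed

section \<open>Projections onto subspaces and cylinders\<close>

text \<open>By Pythagoras, the squared distance from \<open>p + q\<close> to a point \<open>t\<close> of \<open>T\<close> exceeds the square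
  of \<open>norm p\<close> by that of \<open>dist q t\<close>.\<close>

lemma proj_point_subspace:
  fixes T :: "'a::euclidean_space set"
  assumes T: "subspace T" and "q \<in> T" and orth: "\<And>t. t \<in> T \<Longrightarrow> p \<bullet> t = 0"
  shows "proj_point T (p + q) = {q}"
proof -
  have pyth: "(dist (p + q) t)\<^sup>2 = (norm p)\<^sup>2 + (dist q t)\<^sup>2" if "t \<in> T" for t
  proof -
    have "p \<bullet> (q - t) = 0" using orth T \<open>q \<in> T\<close> that by (simp add: subspace_diff)
    then show ?thesis
      using norm_add_Pythagorean[of p "q - t"] by (simp add: orthogonal_def dist_norm algebra_simps)
  qed
  have "infdist (p + q) T = norm p"
  proof (rule antisym)
    show "infdist (p + q) T \<le> norm p"
      using infdist_le[OF \<open>q \<in> T\<close>, of "p + q"] by (simp add: dist_norm)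
    have "norm p \<le> dist (p + q) t" if "t \<in> T" for t
      using pyth[OF that] by (simp add: power2_le_imp_le)
    then show "norm p \<le> infdist (p + q) T"
      using \<open>q \<in> T\<close> by (auto simp: infdist_def intro!: cINF_greatest)
  qed
  moreover have "dist (p + q) t = norm p \<longleftrightarrow> t = q" if "t \<in> T" for t
  proof -
    have "dist (p + q) t = norm p \<longleftrightarrow> (dist (p + q) t)\<^sup>2 = (norm p)\<^sup>2"
      by (simp add: power2_eq_iff_nonneg)
    then show ?thesis using pyth[OF that] by auto
  qed
  ultimately show ?thesis
    using \<open>q \<in> T\<close> by (auto simp: proj_point_def dist_norm norm_minus_commute)
qed

lemma proj_point_Times_UNIV:
  fixes T :: "'a::euclidean_space set" and b :: "'b::euclidean_space"
  shows "proj_point (T \<times> UNIV) (a, b) = proj_point T a \<times> {b}"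
proof (cases "T = {}")
  case False
  have inf: "infdist (a, b) (T \<times> UNIV) = infdist a T"
  proof (rule antisym)
    have "infdist (a, b) (T \<times> UNIV) \<le> dist a t" if "t \<in> T" for t
      using infdist_le[of "(t, b)" "T \<times> UNIV" "(a, b)"] that by (simp add: dist_Pair_Pair)
    then show "infdist (a, b) (T \<times> UNIV) \<le> infdist a T"
      unfolding infdist_def[of a] using False by (auto intro!: cINF_greatest)
    have "infdist a T \<le> dist (a, b) (t, s)" if "t \<in> T" for t s
      using infdist_le[OF that, of a] dist_fst_le[of "(a, b)" "(t, s)"] by simp
    then show "infdist a T \<le> infdist (a, b) (T \<times> UNIV)"
      unfolding infdist_def[of "(a, b)"] using False by (auto intro!: cINF_greatest)
  qed
  have "norm (t - a, s - b) = infdist a T \<longleftrightarrow> norm (t - a) = infdist a T \<and> s = b"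
    if "t \<in> T" for t s
  proof
    assume eq: "norm (t - a, s - b) = infdist a T"
    have "infdist a T \<le> norm (t - a)"
      using infdist_le[OF that, of a] by (simp add: dist_norm norm_minus_commute)
    then have "(norm (t - a, s - b))\<^sup>2 \<le> (norm (t - a))\<^sup>2"
      using eq by (simp add: infdist_nonneg power_mono)
    then have "s = b" by (simp add: norm_Pair)
    with eq show "norm (t - a) = infdist a T \<and> s = b" by (simp add: norm_Pair)
  qed (simp add: norm_Pair infdist_nonneg)
  then show ?thesis
    by (auto simp: proj_point_def inf)
qed (simp add: proj_point_def)

section \<open>Regular and limiting normals\<close>

text \<open>Clearing the denominator avoids extended reals, and both sides hold vacuously at an isolated
  point.\<close>

lemma regular_normal_cone_iff:
  "v \<in> regular_normal_cone C x \<longleftrightarrow> x \<in> C \<and>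
    (\<forall>e>0. \<forall>\<^sub>F y in at x within C. v \<bullet> (y - x) \<le> e * norm (y - x))"
proof -
  have "Limsup (at x within C) (\<lambda>y. ereal (v \<bullet> (y - x) / norm (y - x))) \<le> 0 \<longleftrightarrow>
      (\<forall>e>0. \<forall>\<^sub>F y in at x within C. v \<bullet> (y - x) \<le> e * norm (y - x))"
    (is "?L \<longleftrightarrow> ?R")
  proof
    assume L: ?L
    show ?R
    proof (intro allI impI)
      fix e :: real assume "e > 0"
      with L have "\<forall>\<^sub>F y in at x within C. ereal (v \<bullet> (y - x) / norm (y - x)) < ereal e"
        unfolding Limsup_le_iff by (metis ereal_less(2))
      moreover have "\<forall>\<^sub>F y in at x within C. y \<noteq> x"
        by (simp add: eventually_at_filter)
      ultimately show "\<forall>\<^sub>F y in at x within C. v \<bullet> (y - x) \<le> e * norm (y - x)"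
        by eventually_elim (simp add: divide_simps)
    qed
  next
    assume R: ?R
    show ?L
      unfolding Limsup_le_iff
    proof (intro allI impI)
      fix c :: ereal assume "c > 0"
      then obtain e where e: "0 < ereal e" "ereal e < c"
        using ereal_dense2[of 0 c] by blast
      then have "\<forall>\<^sub>F y in at x within C. v \<bullet> (y - x) \<le> e * norm (y - x)" using R by auto
      moreover have "\<forall>\<^sub>F y in at x within C. y \<noteq> x"
        by (simp add: eventually_at_filter)
      ultimately show "\<forall>\<^sub>F y in at x within C. ereal (v \<bullet> (y - x) / norm (y - x)) < c"
      proof eventually_elim
        case (elim y)
        then have "ereal (v \<bullet> (y - x) / norm (y - x)) \<le> ereal e"
          by (simp add: divide_simps)
        with e(2) show ?case by order
      qed
    qed
  qed
  then show ?thesis by (auto simp: regular_normal_cone_def)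
qed

lemma regular_normal_cone_zero: "x \<in> C \<Longrightarrow> 0 \<in> regular_normal_cone C x"
  by (simp add: regular_normal_cone_iff)

lemma regular_normal_cone_add:
  assumes "v \<in> regular_normal_cone C x" "w \<in> regular_normal_cone C x"
  shows "v + w \<in> regular_normal_cone C x"
  unfolding regular_normal_cone_iff
proof (intro conjI allI impI)
  show "x \<in> C" using assms by (simp add: regular_normal_cone_iff)
  fix e :: real assume "e > 0"
  then have "\<forall>\<^sub>F y in at x within C. v \<bullet> (y - x) \<le> e/2 * norm (y - x)"
    "\<forall>\<^sub>F y in at x within C. w \<bullet> (y - x) \<le> e/2 * norm (y - x)"
    using assms unfolding regular_normal_cone_iff by (meson half_gt_zero)+
  then show "\<forall>\<^sub>F y in at x within C. (v + w) \<bullet> (y - x) \<le> e * norm (y - x)"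
    by eventually_elim (simp add: inner_add_left)
qed

lemma regular_normal_cone_scaleR:
  assumes v: "v \<in> regular_normal_cone C x" and c: "0 \<le> (c::real)"
  shows "c *\<^sub>R v \<in> regular_normal_cone C x"
proof (cases "c = 0")
  case True
  then show ?thesis using v by (simp add: regular_normal_cone_iff)
next
  case False
  with c have "c > 0" by simp
  show ?thesis
    unfolding regular_normal_cone_iff
  proof (intro conjI allI impI)
    show "x \<in> C" using v by (simp add: regular_normal_cone_iff)
    fix e :: real assume "e > 0"
    then have "\<forall>\<^sub>F y in at x within C. v \<bullet> (y - x) \<le> e/c * norm (y - x)"
      using v \<open>c > 0\<close> unfolding regular_normal_cone_iff by (meson divide_pos_pos)
    then show "\<forall>\<^sub>F y in at x within C. (c *\<^sub>R v) \<bullet> (y - x) \<le> e * norm (y - x)"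
      by eventually_elim (use \<open>c > 0\<close> in \<open>simp add: field_simps\<close>)
  qed
qed

text \<open>Dividing the defining estimate of a regular normal by the step length \<open>t k\<close> along a tangent
  sequence and passing to the limit bounds the inner product by every positive multiple of \<open>norm w\<close>.\<close>

lemma regular_normal_inner_tangent_le:
  assumes v: "v \<in> regular_normal_cone C x" and w: "w \<in> tangent_cone C x"
  shows "v \<bullet> w \<le> 0"
proof -
  have "w \<in> outer_limit (at_right 0) (\<lambda>t::real. (\<lambda>c. (c - x) /\<^sub>R t) ` C)"
    using w by (simp add: tangent_cone_def split: if_splits)
  then obtain t ws where t: "filterlim t (at_right (0::real)) sequentially"
    and ws: "\<And>k. ws k \<in> (\<lambda>c. (c - x) /\<^sub>R t k) ` C" "ws \<longlonglongrightarrow> w"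
    unfolding outer_limit_def by auto
  obtain c where c: "\<And>k. c k \<in> C" "\<And>k. ws k = (c k - x) /\<^sub>R t k"
    using ws(1) unfolding image_iff by metis
  have t0: "t \<longlonglongrightarrow> 0" and tpos: "\<forall>\<^sub>F k in sequentially. t k > 0"
    using t by (auto simp: filterlim_at eventually_conj_iff)
  have ck: "\<forall>\<^sub>F k in sequentially. c k - x = t k *\<^sub>R ws k"
    using tpos by eventually_elim (simp add: c(2))
  have "(\<lambda>k. x + t k *\<^sub>R ws k) \<longlonglongrightarrow> x + 0 *\<^sub>R w"
    by (intro tendsto_intros t0 ws(2))
  moreover have "\<forall>\<^sub>F k in sequentially. x + t k *\<^sub>R ws k = c k"
    using ck by eventually_elim (metis add.commute diff_add_cancel)
  ultimately have cx: "c \<longlonglongrightarrow> x"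
    using Lim_transform_eventually by fastforce
  have le: "v \<bullet> w \<le> e * norm w" if "e > 0" for e
  proof -
    have "\<forall>\<^sub>F y in at x within C. v \<bullet> (y - x) \<le> e * norm (y - x)"
      using v that by (simp add: regular_normal_cone_iff)
    then have "\<forall>\<^sub>F y in nhds x. y \<in> C \<longrightarrow> v \<bullet> (y - x) \<le> e * norm (y - x)"
      unfolding eventually_at_filter by (rule eventually_mono) auto
    then have "\<forall>\<^sub>F k in sequentially. c k \<in> C \<longrightarrow> v \<bullet> (c k - x) \<le> e * norm (c k - x)"
      using cx by (rule eventually_compose_filterlim)
    then have "\<forall>\<^sub>F k in sequentially. v \<bullet> ws k \<le> e * norm (ws k)"
      using ck tpos
      by eventually_elim (use c(1) in \<open>simp add: mult.left_commute\<close>)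
    moreover have "(\<lambda>k. v \<bullet> ws k) \<longlonglongrightarrow> v \<bullet> w" "(\<lambda>k. e * norm (ws k)) \<longlonglongrightarrow> e * norm w"
      by (intro tendsto_intros ws(2))+
    ultimately show ?thesis
      by (intro tendsto_le[OF trivial_limit_sequentially])
  qed
  show ?thesis
  proof (rule field_le_epsilon)
    fix e :: real assume "e > 0"
    then have "v \<bullet> w \<le> e / (norm w + 1) * norm w"
      by (intro le divide_pos_pos) (auto intro: add_nonneg_pos)
    also have "\<dots> = e * norm w / (norm w + 1)" by simp
    also have "\<dots> \<le> e"
      using \<open>e > 0\<close> by (subst pos_divide_le_eq) (simp_all add: algebra_simps add_pos_nonneg)
    finally show "v \<bullet> w \<le> 0 + e" by simp
  qed
qed

text \<open>A point of \<open>C\<close> near \<open>z\<close> projects to a point of \<open>X\<close> near \<open>fst z\<close> at no larger distance, so the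
  estimate for \<open>g\<close> carries over to \<open>(g, 0)\<close>.\<close>

lemma regular_normal_cone_add_cylinder:
  fixes X :: "'a::euclidean_space set" and C :: "('a \<times> 'b::euclidean_space) set"
  assumes C: "C \<subseteq> X \<times> UNIV" and v: "v \<in> regular_normal_cone C z"
    and g: "g \<in> regular_normal_cone X (fst z)"
  shows "v + (g, 0) \<in> regular_normal_cone C z"
proof (rule regular_normal_cone_add[OF v])
  have z: "z \<in> C" using v by (simp add: regular_normal_cone_iff)
  show "(g, 0) \<in> regular_normal_cone C z"
    unfolding regular_normal_cone_iff
  proof (intro conjI z allI impI)
    fix e :: real assume "e > 0"
    then have "\<forall>\<^sub>F y in at (fst z) within X. g \<bullet> (y - fst z) \<le> e * norm (y - fst z)"
      using g by (simp add: regular_normal_cone_iff)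
    then have "\<forall>\<^sub>F y in nhds (fst z). y \<in> X \<longrightarrow> g \<bullet> (y - fst z) \<le> e * norm (y - fst z)"
      unfolding eventually_at_filter by (rule eventually_mono) auto
    moreover have "filterlim fst (nhds (fst z)) (nhds z)"
      using tendsto_fst[OF filterlim_ident] by blast
    ultimately have "\<forall>\<^sub>F y in nhds z. fst y \<in> X \<longrightarrow>
        g \<bullet> (fst y - fst z) \<le> e * norm (fst y - fst z)"
      by (rule eventually_compose_filterlim)
    then show "\<forall>\<^sub>F y in at z within C. (g, 0) \<bullet> (y - z) \<le> e * norm (y - z)"
      unfolding eventually_at_filter
    proof eventually_elim
      case (elim y)
      have "norm (fst (y - z)) \<le> norm (y - z)" using norm_fst_le[of "fst (y - z)" "snd (y - z)"] by (simp only: prod.collapse)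
      then have "e * norm (fst y - fst z) \<le> e * norm (y - z)"
        using \<open>e > 0\<close> by simp
      then show ?case using elim C by (auto simp: inner_prod_def)
    qed
  qed
qed

text \<open>A single normal of \<open>X\<close> at \<open>fst z\<close> would not suffice here: limiting normals of \<open>C\<close> at \<open>z\<close>
  come from regular normals at nearby points, and the regular normal of \<open>X\<close> must follow them.
  This is why a continuous field \<open>p\<close> of regular normals is required.\<close>

lemma normal_cone_add_cylinder:
  fixes X :: "'a::euclidean_space set" and C :: "('a \<times> 'b::euclidean_space) set"
  assumes C: "C \<subseteq> X \<times> UNIV" and v: "v \<in> normal_cone C z"
    and W: "open W" "fst z \<in> W"
    and p: "continuous_on W p" "\<And>x. x \<in> X \<inter> W \<Longrightarrow> p x \<in> regular_normal_cone X x"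
  shows "v + (p (fst z), 0) \<in> normal_cone C z"
proof -
  have z: "z \<in> C" and v: "v \<in> outer_limit (nhds_in z C) (regular_normal_cone C)"
    using v by (auto simp: normal_cone_def split: if_splits)
  have "v + (p (fst z), 0) \<in> outer_limit (nhds_in z C) (regular_normal_cone C)"
    unfolding outer_limit_nhds_in_iff
  proof (intro allI impI)
    fix e :: real assume "e > 0"
    have "isCont p (fst z)"
      using p(1) W continuous_on_eq_continuous_at by blast
    then have "\<forall>\<^sub>F x in nhds (fst z). dist (p x) (p (fst z)) < e/2"
      using \<open>e > 0\<close> unfolding isCont_def tendsto_at_iff_tendsto_nhds by (intro tendstoD) auto
    moreover have "\<forall>\<^sub>F x in nhds (fst z). x \<in> W"
      using W by (rule eventually_nhds_in_open)
    ultimately have "\<forall>\<^sub>F x in nhds (fst z). x \<in> W \<and> dist (p x) (p (fst z)) < e/2"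
      by eventually_elim simp
    then obtain d where d: "d > 0"
      "\<And>x. dist x (fst z) < d \<Longrightarrow> x \<in> W \<and> dist (p x) (p (fst z)) < e/2"
      unfolding eventually_nhds_metric by blast
    obtain y w where y: "y \<in> C" "w \<in> regular_normal_cone C y"
      "dist y z < min d (e/2)" "dist w v < min d (e/2)"
      using v \<open>e > 0\<close> \<open>d > 0\<close> unfolding outer_limit_nhds_in_iff
      by (metis half_gt_zero min_less_iff_conj)
    have fy: "dist (fst y) (fst z) < d"
      using dist_fst_le[of y z] y(3) by simp
    have "fst y \<in> X \<inter> W" using C y(1) d(2)[OF fy] by auto
    then have "w + (p (fst y), 0) \<in> regular_normal_cone C y"
      using regular_normal_cone_add_cylinder[OF C y(2)] p(2) by blast
    moreover have "dist (w + (p (fst y), 0)) (v + (p (fst z), 0)) < e"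
    proof -
      have "dist (w + (p (fst y), 0)) (v + (p (fst z), 0))
          \<le> dist w v + dist (p (fst y), 0::'b) (p (fst z), 0)"
        by (rule dist_triangle_add)
      also have "\<dots> < e/2 + e/2"
        using y(4) d(2)[OF fy] by (simp add: dist_Pair_Pair add_strict_mono)
      finally show ?thesis by simp
    qed
    moreover have "dist y z < e" using y(3) \<open>e > 0\<close> by simp
    ultimately show "\<exists>y\<in>C. \<exists>w\<in>regular_normal_cone C y. dist y z < e \<and>
        dist w (v + (p (fst z), 0)) < e"
      using y(1) by blast
  qed
  with z show ?thesis by (simp add: normal_cone_def)
qed

lemma outer_limit_normal_cone:
  assumes "z \<in> C"
  shows "outer_limit (nhds_in z C) (normal_cone C) = normal_cone C z"
  using assms outer_limit_nhds_in_idem[of C "normal_cone C" "regular_normal_cone C" z]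
  by (simp add: normal_cone_def)

section \<open>Tangents and normals of a smooth manifold\<close>

text \<open>The difference quotients of the curve along \<open>t = 1/(k+1)\<close> form a tangent sequence. Membership
  of the curve in \<open>C\<close> is only eventual, while the outer limit asks for it at every index, so a
  finite initial segment is dropped.\<close>

lemma tangent_cone_vector_derivative:
  assumes "x \<in> C" and c: "(c has_vector_derivative w) (at 0)" and c0: "c 0 = x"
    and cC: "\<forall>\<^sub>F t in at_right 0. c t \<in> C"
  shows "w \<in> tangent_cone C x"
proof -
  have "((\<lambda>t. (c t - x) /\<^sub>R t) \<longlongrightarrow> w) (at 0)"
  proof (rule Lim_null_comparison[THEN Lim_null[THEN iffD2]])
    show "((\<lambda>t. norm (c (0 + t) - c 0 - t *\<^sub>R w) / norm t) \<longlongrightarrow> 0) (at 0)"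
      using c unfolding has_vector_derivative_def has_derivative_at by blast
    have "norm ((c t - x) /\<^sub>R t - w) = norm (c (0 + t) - c 0 - t *\<^sub>R w) / norm t" if "t \<noteq> 0" for t
    proof -
      have "(c t - x) /\<^sub>R t - w = (c (0 + t) - c 0 - t *\<^sub>R w) /\<^sub>R t"
        using that c0 by (simp add: scaleR_diff_right)
      then show ?thesis by (simp add: divide_inverse mult.commute)
    qed
    then show "\<forall>\<^sub>F t in at 0. norm ((c t - x) /\<^sub>R t - w)
        \<le> norm (c (0 + t) - c 0 - t *\<^sub>R w) / norm t"
      unfolding eventually_at_filter by (intro always_eventually) simp
  qed
  then have lim: "((\<lambda>t. (c t - x) /\<^sub>R t) \<longlongrightarrow> w) (at_right 0)"
    by (rule filterlim_mono) (auto simp: at_le)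
  define s where "s k = inverse (real (Suc k))" for k
  have "filterlim s (at_right 0) sequentially"
    unfolding s_def filterlim_at using LIMSEQ_inverse_real_of_nat by simp
  then have "\<forall>\<^sub>F k in sequentially. c (s k) \<in> C"
    using cC eventually_compose_filterlim by blast
  then obtain N where N: "\<And>k. k \<ge> N \<Longrightarrow> c (s k) \<in> C"
    unfolding eventually_sequentially by blast
  have f: "filterlim (\<lambda>k. s (k + N)) (at_right 0) sequentially"
    using \<open>filterlim s (at_right 0) sequentially\<close> by (rule filterlim_compose[OF _ filterlim_add_const_nat_at_top])
  then have "(\<lambda>k. (c (s (k + N)) - x) /\<^sub>R s (k + N)) \<longlonglongrightarrow> w"
    by (rule filterlim_compose[OF lim])
  then have "w \<in> outer_limit (at_right 0) (\<lambda>t. (\<lambda>c. (c - x) /\<^sub>R t) ` C)"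
    unfolding outer_limit_def mem_Collect_eq
    using f N by (intro exI[of _ "\<lambda>k. s (k + N)"] exI conjI) auto
  then show ?thesis using \<open>x \<in> C\<close> by (simp add: tangent_cone_def)
qed

text \<open>On \<open>X\<close> near \<open>x\<close> both values of \<open>f\<close> vanish, so the first-order expansion of \<open>f\<close> leaves
  only the inner product with \<open>g\<close>, up to a small remainder.\<close>

lemma gradient_regular_normal:
  assumes "open U" "x \<in> X \<inter> U" and f: "GDERIV f x :> g" and "\<And>y. y \<in> X \<inter> U \<Longrightarrow> f y = 0"
  shows "g \<in> regular_normal_cone X x"
  unfolding regular_normal_cone_iff
proof (intro conjI allI impI)
  show "x \<in> X" using assms by simp
  fix e :: real assume "e > 0"
  have "\<exists>d>0. \<forall>y. norm (y - x) < d \<longrightarrow> norm (f y - f x - (y - x) \<bullet> g) \<le> e * norm (y - x)"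
    using f \<open>e > 0\<close> unfolding gderiv_def has_derivative_at_alt by blast
  then have "\<forall>\<^sub>F y in nhds x. norm (f y - f x - (y - x) \<bullet> g) \<le> e * norm (y - x)"
    unfolding eventually_nhds_metric by (simp add: dist_norm)
  moreover have "\<forall>\<^sub>F y in nhds x. y \<in> U"
    using assms(1,2) by (auto intro: eventually_nhds_in_open)
  ultimately show "\<forall>\<^sub>F y in at x within X. g \<bullet> (y - x) \<le> e * norm (y - x)"
    unfolding eventually_at_filter
    by eventually_elim (use assms(2,4) in \<open>auto simp: inner_commute\<close>)
qed

text \<open>The rank condition speaks of a set of gradients. Having dimension \<open>m\<close>, the set of at most \<open>m\<close>
  vectors has no repetitions and is independent, and so the indexed family is independent.\<close>

lemma independent_family_sum_eq_0:
  fixes g :: "nat \<Rightarrow> 'a::euclidean_space"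
  assumes "dim (g ` {..<m}) = m" and "(\<Sum>i<m. c i *\<^sub>R g i) = 0" and "i < m"
  shows "c i = 0"
proof -
  have "card (g ` {..<m}) = m"
    using assms(1) dim_le_card'[of "g ` {..<m}"] card_image_le[of "{..<m}" g] by simp
  then have inj: "inj_on g {..<m}" by (simp add: eq_card_imp_inj_on)
  have ind: "independent (g ` {..<m})"
    by (rule card_le_dim_spanning[of _ "g ` {..<m}"])
      (use assms(1) \<open>card _ = m\<close> in \<open>auto intro: span_base\<close>)
  have "(\<Sum>v\<in>g ` {..<m}. c (the_inv_into {..<m} g v) *\<^sub>R v) = 0"
    using assms(2) by (simp add: sum.reindex[OF inj] the_inv_into_f_f[OF inj])
  from independentD[OF ind _ _ this, of "g i"] show ?thesis
    using assms(3) by (simp add: the_inv_into_f_f[OF inj])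
qed

lemma span_image_lessThan:
  fixes g :: "nat \<Rightarrow> 'a::real_vector"
  assumes "p \<in> span (g ` {..<m})"
  obtains a where "p = (\<Sum>i<m. a i *\<^sub>R g i)"
proof -
  have "\<exists>a. p = (\<Sum>i<m. a i *\<^sub>R g i)"
    using assms
  proof (induction rule: span_induct_alt)
    case base
    show ?case by (rule exI[of _ "\<lambda>_. 0"]) simp
  next
    case (step c x y)
    then obtain i a where "x = g i" "i < m" "y = (\<Sum>i<m. a i *\<^sub>R g i)" by auto
    then have "c *\<^sub>R x + y = (\<Sum>j<m. (a j + (if j = i then c else 0)) *\<^sub>R g j)"
      by (simp add: scaleR_add_left sum.distrib if_distrib[of "\<lambda>c. c *\<^sub>R _"] cong: if_cong)
    then show ?case by (rule exI[of _ "\<lambda>j. a j + (if j = i then c else 0)"])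
  qed
  with that show thesis by blast
qed

text \<open>Let \<open>K\<close> be the kernel of the gradients \<open>g i\<close> at \<open>x0\<close> and \<open>B\<close> a basis of \<open>K\<close>. The map
  \<open>\<Phi>\<close> below, the sum of all \<open>F i y *\<^sub>R g i\<close> for \<open>i < m\<close> and of all
  \<open>(y \<bullet> b) *\<^sub>R b\<close> for \<open>b \<in> B\<close>, sends exactly the common zeros of the \<open>F i\<close> into \<open>K\<close>,
  because the \<open>g i\<close> are independent and orthogonal to \<open>K\<close>. Its derivative at \<open>x0\<close> is
  injective, since the inner product with the argument is a sum of squares. So \<open>\<Phi>\<close> is a local
  diffeomorphism near \<open>x0\<close>. At a zero \<open>x\<close> in its domain, a vector \<open>w\<close> in the kernel of the
  gradients at \<open>x\<close> is mapped by the derivative of \<open>\<Phi>\<close> into \<open>K\<close>, and the preimage of the line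
  in this direction is the curve sought. Keeping \<open>K\<close> and the \<open>g i\<close> fixed
  while \<open>x\<close> varies gives the conclusion on a whole neighborhood of \<open>x0\<close>, although the rank
  condition is imposed at \<open>x0\<close> alone.\<close>

lemma smooth_manifold_straightening:
  fixes F :: "nat \<Rightarrow> 'a::euclidean_space \<Rightarrow> real"
  assumes U: "open U" "x0 \<in> U"
    and F: "\<And>i x. i < m \<Longrightarrow> x \<in> U \<Longrightarrow> GDERIV (F i) x :> G i x"
    and G: "\<And>i. i < m \<Longrightarrow> continuous_on U (G i)"
    and full: "dim ((\<lambda>i. G i x0) ` {..<m}) = m"
  obtains W where "open W" "x0 \<in> W" "W \<subseteq> U"
    "\<forall>x\<in>W. \<forall>w. (\<forall>i<m. F i x = 0 \<and> G i x \<bullet> w = 0) \<longrightarrow>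
      (\<exists>c. (c has_vector_derivative w) (at 0) \<and> c 0 = x \<and>
        (\<forall>\<^sub>F t in at_right 0. c t \<in> W \<and> (\<forall>i<m. F i (c t) = 0)))"
proof -
  define g where "g i = G i x0" for i
  define K where "K = {w. \<forall>i<m. g i \<bullet> w = 0}"
  have K: "subspace K"
    unfolding K_def by (auto simp: subspace_def inner_add_right)
  obtain B where B: "B \<subseteq> K" "independent B" "K \<subseteq> span B"
    using basis_exists by metis
  have "finite B" using B(2) by (rule finiteI_independent)
  define P where "P w = (\<Sum>b\<in>B. (w \<bullet> b) *\<^sub>R b)" for w
  have PK: "P w \<in> K" for w
    unfolding P_def using B(1) by (intro subspace_sum[OF K] subspace_scale[OF K]) auto
  define \<Phi> where "\<Phi> y = (\<Sum>i<m. F i y *\<^sub>R g i) + P y" for y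
  define D where "D y h = (\<Sum>i<m. (h \<bullet> G i y) *\<^sub>R g i) + P h" for y h
  have linD: "bounded_linear (D y)" for y
    unfolding D_def P_def
    by (intro bounded_linear_add bounded_linear_sum bounded_linear_scaleR_const
        bounded_linear_inner_left)
  define \<Phi>' where "\<Phi>' y = Blinfun (D y)" for y
  have app: "blinfun_apply (\<Phi>' y) = D y" for y
    unfolding \<Phi>'_def using linD by (rule bounded_linear_Blinfun_apply)
  \<comment> \<open>The \<open>g i\<close> span a complement orthogonal to \<open>K\<close>, so the component of a vector of \<open>K\<close> along
    them is orthogonal to itself.\<close>
  have in_K: "\<forall>i<m. a i = 0" if "(\<Sum>i<m. a i *\<^sub>R g i) + k \<in> K" "k \<in> K" for a k
  proof -
    define s where "s = (\<Sum>i<m. a i *\<^sub>R g i)"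
    have "s \<in> K" using subspace_diff[OF K that] by (simp add: s_def)
    then have "s \<bullet> s = 0"
      unfolding s_def inner_sum_left by (simp add: K_def)
    then have "(\<Sum>i<m. a i *\<^sub>R g i) = 0" by (simp add: s_def)
    then show ?thesis
      using independent_family_sum_eq_0[of g m a] full unfolding g_def by blast
  qed
  have "inj (D x0)"
  proof (subst linear_injective_0)
    show "linear (D x0)" using linD by (rule bounded_linear.linear)
    show "\<forall>h. D x0 h = 0 \<longrightarrow> h = 0"
    proof (intro allI impI)
      fix h assume "D x0 h = 0"
      then have "0 = D x0 h \<bullet> h" by simp
      also have "\<dots> = (\<Sum>i<m. (g i \<bullet> h)\<^sup>2) + (\<Sum>b\<in>B. (b \<bullet> h)\<^sup>2)"
        by (simp add: D_def P_def g_def inner_add_left inner_sum_left power2_eq_square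
            inner_commute[of h])
      finally have *: "(\<Sum>i<m. (g i \<bullet> h)\<^sup>2) + (\<Sum>b\<in>B. (b \<bullet> h)\<^sup>2) = 0" by simp
      then have "(\<Sum>i<m. (g i \<bullet> h)\<^sup>2) = 0" "(\<Sum>b\<in>B. (b \<bullet> h)\<^sup>2) = 0"
        by (smt (verit) sum_nonneg zero_le_power2)+
      then have "h \<in> K" "\<And>b. b \<in> B \<Longrightarrow> h \<bullet> b = 0"
        using \<open>finite B\<close> by (auto simp: sum_nonneg_eq_0_iff K_def inner_commute)
      then have "orthogonal h h"
        using B(3) orthogonal_to_span[of h B h] by (auto simp: orthogonal_def)
      then show "h = 0" by (simp add: orthogonal_def)
    qed
  qed
  then obtain J where J: "linear J" "J \<circ> D x0 = id"
    using linear_injective_left_inverse bounded_linear.linear[OF linD] by blast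
  have invJ: "Blinfun J o\<^sub>L \<Phi>' x0 = id_blinfun"
    using J by (intro blinfun_eqI)
      (simp add: app bounded_linear_Blinfun_apply linear_conv_bounded_linear[symmetric] fun_eq_iff)
  have der: "(\<Phi> has_derivative blinfun_apply (\<Phi>' x)) (at x)" if "x \<in> U" for x
    unfolding app \<Phi>_def D_def P_def
    by (intro has_derivative_add has_derivative_sum has_derivative_scaleR_left
        has_derivative_inner_left has_derivative_ident)
      (use F that in \<open>auto simp: gderiv_def\<close>)
  have cont: "continuous_on U \<Phi>'"
    by (rule continuous_on_blinfun_componentwise)
      (unfold app D_def, intro continuous_intros G, auto)
  obtain W V \<Psi> \<Psi>' where W: "open W" "W \<subseteq> U" "x0 \<in> W" "open V" "homeomorphism W V \<Phi> \<Psi>"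
    and \<Psi>: "\<And>y. y \<in> V \<Longrightarrow> (\<Psi> has_derivative (\<Psi>' y)) (at y)"
    and \<Psi>': "\<And>y. y \<in> V \<Longrightarrow> \<Psi>' y = inv (blinfun_apply (\<Phi>' (\<Psi> y)))"
      "\<And>y. y \<in> V \<Longrightarrow> bij (blinfun_apply (\<Phi>' (\<Psi> y)))"
    using inverse_function_theorem[OF U(1) der cont U(2) invJ] by metis
  show thesis
  proof (rule that[OF W(1,3,2)], intro ballI allI impI)
    fix x w assume x: "x \<in> W" and xw: "\<forall>i<m. F i x = 0 \<and> G i x \<bullet> w = 0"
    define c where "c t = \<Psi> (\<Phi> x + t *\<^sub>R P w)" for t
    have V: "\<Phi> x \<in> V" "\<Psi> (\<Phi> x) = x"
      using W(5) x by (auto simp: homeomorphism_def)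
    have "D x w = P w" using xw by (simp add: D_def inner_commute[of w])
    moreover have "bij (D x)" "\<Psi>' (\<Phi> x) = inv (D x)"
      using \<Psi>'[OF V(1)] by (simp_all add: V(2) app)
    ultimately have w': "\<Psi>' (\<Phi> x) (P w) = w"
      by (metis bij_is_inj inv_f_f)
    have line: "((\<lambda>t. \<Phi> x + t *\<^sub>R P w) has_derivative (\<lambda>t. t *\<^sub>R P w)) (at 0)"
      by (auto intro!: derivative_eq_intros)
    have "(c has_derivative (\<lambda>t. \<Psi>' (\<Phi> x) (t *\<^sub>R P w))) (at 0)"
      unfolding c_def
      by (rule has_derivative_compose[OF line]) (use \<Psi>[OF V(1)] in simp)
    then have "(c has_vector_derivative w) (at 0)"
      unfolding has_vector_derivative_def
      using linear_scale[OF has_derivative_linear[OF \<Psi>[OF V(1)]]] w' by simp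
    moreover have "c 0 = x" by (simp add: c_def V(2))
    moreover have "\<forall>\<^sub>F t in at_right 0. c t \<in> W \<and> (\<forall>i<m. F i (c t) = 0)"
    proof -
      have "((\<lambda>t. \<Phi> x + t *\<^sub>R P w) \<longlongrightarrow> \<Phi> x + 0 *\<^sub>R P w) (at_right 0)"
        by (intro tendsto_intros)
      then have "\<forall>\<^sub>F t in at_right 0. \<Phi> x + t *\<^sub>R P w \<in> V"
        using topological_tendstoD[OF _ W(4)] V(1) by fastforce
      then show ?thesis
      proof eventually_elim
        case (elim t)
        then have cW: "c t \<in> W" and \<Phi>c: "\<Phi> (c t) = \<Phi> x + t *\<^sub>R P w"
          using W(5) by (auto simp: homeomorphism_def c_def)
        have "\<Phi> x \<in> K" using xw PK by (simp add: \<Phi>_def)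
        then have "\<Phi> (c t) \<in> K"
          unfolding \<Phi>c by (intro subspace_add[OF K] subspace_scale[OF K] PK)
        then have "\<forall>i<m. F i (c t) = 0"
          unfolding \<Phi>_def using PK by (rule in_K)
        with cW show ?case by simp
      qed
    qed
    ultimately show "\<exists>c. (c has_vector_derivative w) (at 0) \<and> c 0 = x \<and>
        (\<forall>\<^sub>F t in at_right 0. c t \<in> W \<and> (\<forall>i<m. F i (c t) = 0))"
      by blast
  qed
qed

text \<open>A tangent vector is orthogonal to every gradient because both the gradient and its negative
  are regular normals. The converse inclusion uses the curves from the straightening lemma.\<close>

lemma smooth_manifold_local_geometry:
  fixes X :: "'a::euclidean_space set"
  assumes "smooth_manifold_around X x0"
  obtains W m G where "open W" "x0 \<in> W" "\<forall>i<m::nat. continuous_on W (G i)"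
    "\<forall>x\<in>X \<inter> W. tangent_cone X x = {w. \<forall>i<m. G i x \<bullet> w = 0}"
    "\<forall>x\<in>X \<inter> W. \<forall>a. (\<Sum>i<m. a i *\<^sub>R G i x) \<in> regular_normal_cone X x"
proof -
  obtain m U F G where U: "open U" "x0 \<in> U"
    and F: "\<And>i x. i < m \<Longrightarrow> x \<in> U \<Longrightarrow> GDERIV (F i) x :> G i x"
    and G: "\<And>i. i < m \<Longrightarrow> continuous_on U (G i)"
    and X: "X \<inter> U = {x \<in> U. \<forall>i<m. F i x = 0}"
    and full: "dim ((\<lambda>i. G i x0) ` {..<m::nat}) = m"
    using assms unfolding smooth_manifold_around_def by (elim conjE exE) (rule that, auto)
  obtain W where W: "open W" "x0 \<in> W" "W \<subseteq> U"
    and curve: "\<forall>x\<in>W. \<forall>w. (\<forall>i<m. F i x = 0 \<and> G i x \<bullet> w = 0) \<longrightarrow>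
      (\<exists>c. (c has_vector_derivative w) (at 0) \<and> c 0 = x \<and>
        (\<forall>\<^sub>F t in at_right 0. c t \<in> W \<and> (\<forall>i<m. F i (c t) = 0)))"
    using smooth_manifold_straightening[of U x0 m F G, OF U F G full] by blast
  have F0: "F i x = 0" if "x \<in> X \<inter> W" "i < m" for x i
    using X W(3) that by auto
  have normal: "G i x \<in> regular_normal_cone X x" "- G i x \<in> regular_normal_cone X x"
    if "x \<in> X \<inter> W" "i < m" for x i
  proof -
    have "GDERIV (F i) x :> G i x" using F W(3) that by auto
    then show "G i x \<in> regular_normal_cone X x"
      using gradient_regular_normal[OF W(1) that(1)] F0 that(2) by blast
    have "GDERIV (\<lambda>y. - F i y) x :> - G i x"
      using \<open>GDERIV (F i) x :> G i x\<close> by (rule GDERIV_minus)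
    then show "- G i x \<in> regular_normal_cone X x"
      by (rule gradient_regular_normal[OF W(1) that(1)]) (use F0 that(2) in simp)
  qed
  have span: "(\<Sum>i\<in>I. a i *\<^sub>R G i x) \<in> regular_normal_cone X x"
    if "x \<in> X \<inter> W" "finite I" "I \<subseteq> {..<m}" for x a I
    using that(2,3)
  proof (induction I rule: finite_induct)
    case empty
    then show ?case using that(1) by (simp add: regular_normal_cone_zero)
  next
    case (insert i I)
    have "a i *\<^sub>R G i x \<in> regular_normal_cone X x"
    proof (cases "0 \<le> a i")
      case True
      then show ?thesis using normal(1)[OF that(1)] insert.prems
        by (simp add: regular_normal_cone_scaleR)
    next
      case False
      then have "(- a i) *\<^sub>R (- G i x) \<in> regular_normal_cone X x"
        using normal(2)[OF that(1)] insert.prems by (intro regular_normal_cone_scaleR) auto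
      then show ?thesis by simp
    qed
    then show ?case using insert by (simp add: regular_normal_cone_add)
  qed
  show thesis
  proof (rule that[OF W(1,2)]; intro allI ballI impI)
    show "continuous_on W (G i)" if "i < m" for i
      using G[OF that] W(3) by (rule continuous_on_subset)
    show "(\<Sum>i<m. a i *\<^sub>R G i x) \<in> regular_normal_cone X x" if "x \<in> X \<inter> W" for x a
      using span[OF that] by blast
    show "tangent_cone X x = {w. \<forall>i<m. G i x \<bullet> w = 0}" if x: "x \<in> X \<inter> W" for x
    proof (intro set_eqI iffI)
      fix w assume w: "w \<in> tangent_cone X x"
      then show "w \<in> {w. \<forall>i<m. G i x \<bullet> w = 0}"
        using regular_normal_inner_tangent_le[OF normal(1)[OF x] w]
          regular_normal_inner_tangent_le[OF normal(2)[OF x] w] by fastforce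
    next
      fix w assume "w \<in> {w. \<forall>i<m. G i x \<bullet> w = 0}"
      then obtain c where "(c has_vector_derivative w) (at 0)" "c 0 = x"
        and c: "\<forall>\<^sub>F t in at_right 0. c t \<in> W \<and> (\<forall>i<m. F i (c t) = 0)"
        using curve x F0[OF x] by blast
      moreover have "\<forall>\<^sub>F t in at_right 0. c t \<in> X"
        using c by eventually_elim (use X W(3) in blast)
      ultimately show "w \<in> tangent_cone X x"
        using tangent_cone_vector_derivative x by blast
    qed
  qed
qed

section \<open>Projected normals over a smooth manifold\<close>

text \<open>Split the first component of a normal as \<open>p + q\<close> with \<open>p\<close> in the span of the gradients and
  \<open>q\<close> orthogonal to it, hence tangent. The projection keeps \<open>q\<close> and discards \<open>p\<close>. Extending
  \<open>- p\<close> to a field of gradient combinations with fixed coefficients shows that the projected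
  vector is still normal to \<open>C\<close>.\<close>

lemma proj_set_normal_cone_over_manifold:
  fixes X :: "'a::euclidean_space set" and C :: "('a \<times> 'b::euclidean_space) set"
  assumes C: "C \<subseteq> X \<times> UNIV" and W: "open W" "x \<in> X \<inter> W"
    and G: "\<And>i::nat. i < m \<Longrightarrow> continuous_on W (G i)"
    and T: "tangent_cone X x = {w. \<forall>i<m. G i x \<bullet> w = 0}"
    and N: "\<And>x a. x \<in> X \<inter> W \<Longrightarrow> (\<Sum>i<m. a i *\<^sub>R G i x) \<in> regular_normal_cone X x"
  shows "proj_set (tangent_cone X x \<times> UNIV) (normal_cone C (x, u)) =
    {v \<in> normal_cone C (x, u). \<forall>i<m. G i x \<bullet> fst v = 0}"
proof -
  have sub: "subspace (tangent_cone X x)"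
    unfolding T by (auto simp: subspace_def inner_add_right)
  show ?thesis
  proof (intro set_eqI iffI)
    fix v assume "v \<in> {v \<in> normal_cone C (x, u). \<forall>i<m. G i x \<bullet> fst v = 0}"
    then have v: "v \<in> normal_cone C (x, u)" "fst v \<in> tangent_cone X x" by (auto simp: T)
    have "fst v \<in> proj_point (tangent_cone X x) (fst v)"
      using proj_point_subspace[OF sub v(2), of 0] by simp
    then have "v \<in> proj_point (tangent_cone X x \<times> UNIV) v"
      using proj_point_Times_UNIV[of "tangent_cone X x" "fst v" "snd v"] by (cases v) auto
    with v(1) show "v \<in> proj_set (tangent_cone X x \<times> UNIV) (normal_cone C (x, u))"
      by (auto simp: proj_set_def)
  next
    fix v assume "v \<in> proj_set (tangent_cone X x \<times> UNIV) (normal_cone C (x, u))"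
    then obtain a b where ab: "(a, b) \<in> normal_cone C (x, u)"
      "v \<in> proj_point (tangent_cone X x) a \<times> {b}"
      by (auto simp: proj_set_def simp flip: proj_point_Times_UNIV)
    obtain p q where pq: "p \<in> span ((\<lambda>i. G i x) ` {..<m})" "a = p + q"
      and orth: "\<And>y. y \<in> span ((\<lambda>i. G i x) ` {..<m}) \<Longrightarrow> orthogonal q y"
      using orthogonal_subspace_decomp_exists[of "(\<lambda>i. G i x) ` {..<m}" a] by metis
    obtain \<alpha> where \<alpha>: "p = (\<Sum>i<m. \<alpha> i *\<^sub>R G i x)"
      using span_image_lessThan[OF pq(1)] by metis
    have qT: "q \<in> tangent_cone X x"
      using orth by (auto simp: T orthogonal_def inner_commute[of _ q] span_base)
    have "p \<bullet> t = 0" if "t \<in> tangent_cone X x" for t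
      using that by (simp add: \<alpha> T inner_sum_left)
    then have "proj_point (tangent_cone X x) a = {q}"
      unfolding pq(2) using sub qT by (intro proj_point_subspace)
    with ab(2) have v: "v = (q, b)" by auto
    have "(a, b) + ((\<lambda>y. \<Sum>i<m. (- \<alpha> i) *\<^sub>R G i y) (fst (x, u)), 0) \<in> normal_cone C (x, u)"
      by (rule normal_cone_add_cylinder[OF C ab(1) W(1)])
        (use W(2) N[of _ "\<lambda>i. - \<alpha> i"] in \<open>auto intro!: continuous_intros G\<close>)
    moreover have "(\<Sum>i<m. (- \<alpha> i) *\<^sub>R G i x) = - p"
      by (simp add: \<alpha> sum_negf)
    ultimately have "v \<in> normal_cone C (x, u)" by (simp add: v pq(2))
    with v qT show "v \<in> {v \<in> normal_cone C (x, u). \<forall>i<m. G i x \<bullet> fst v = 0}"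
      by (simp add: T)
  qed
qed

text \<open>Near the base point the projected normals are cut out of the normal cone by linear equations
  with continuous coefficients, and these pass to the limit.\<close>

lemma osc_projected_normals:
  fixes X :: "'a::euclidean_space set" and S :: "'a \<Rightarrow> 'b::euclidean_space set"
  assumes "smooth_manifold_around X x" "u \<in> S x"
  shows "osc_relative_at (projected_normals X S) (gph (sv_restrict S X)) (x, u)"
proof -
  define C where "C = gph (sv_restrict S X)"
  obtain W G and m :: nat where W: "open W" "x \<in> W" and G: "\<forall>i<m. continuous_on W (G i)"
    and T: "\<forall>x\<in>X \<inter> W. tangent_cone X x = {w. \<forall>i<m. G i x \<bullet> w = 0}"
    and N: "\<forall>x\<in>X \<inter> W. \<forall>a. (\<Sum>i<m. a i *\<^sub>R G i x) \<in> regular_normal_cone X x"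
    using smooth_manifold_local_geometry[OF assms(1)] by blast
  have x: "x \<in> X \<inter> W" using assms(1) W(2) by (simp add: smooth_manifold_around_def)
  have C: "C \<subseteq> X \<times> UNIV" and xuC: "(x, u) \<in> C"
    using x assms(2) by (auto simp: C_def gph_def sv_restrict_def split: if_splits)
  have PN: "projected_normals X S z = {v \<in> normal_cone C z. \<forall>i<m. G i (fst z) \<bullet> fst v = 0}"
    if "fst z \<in> X \<inter> W" for z
  proof -
    have "proj_set (tangent_cone X (fst z) \<times> UNIV) (normal_cone C (fst z, snd z)) =
        {v \<in> normal_cone C (fst z, snd z). \<forall>i<m. G i (fst z) \<bullet> fst v = 0}"
      by (rule proj_set_normal_cone_over_manifold[OF C W(1) that]) (use G T N that in auto)
    then show ?thesis by (simp add: projected_normals_def C_def split_beta)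
  qed
  have "v \<in> projected_normals X S (x, u)"
    if v: "v \<in> outer_limit (nhds_in (x, u) C) (projected_normals X S)" for v
  proof -
    obtain z w where z: "filterlim z (nhds_in (x, u) C) sequentially"
      and w: "\<And>k. w k \<in> projected_normals X S (z k)" "w \<longlonglongrightarrow> v"
      using v unfolding outer_limit_def by blast
    have zlim: "z \<longlonglongrightarrow> (x, u)" and zC: "\<forall>\<^sub>F k in sequentially. z k \<in> C"
      using z by (auto simp: nhds_in_def filterlim_inf filterlim_principal)
    have fz: "(\<lambda>k. fst (z k)) \<longlonglongrightarrow> x" using tendsto_fst[OF zlim] by simp
    then have "\<forall>\<^sub>F k in sequentially. fst (z k) \<in> W"
      using W by (rule topological_tendstoD)
    with zC have ev: "\<forall>\<^sub>F k in sequentially. w k \<in> normal_cone C (z k) \<and>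
        (\<forall>i<m. G i (fst (z k)) \<bullet> fst (w k) = 0)"
    proof eventually_elim
      case (elim k)
      then have "fst (z k) \<in> X \<inter> W" using C by auto
      then show ?case using w(1)[of k] PN by simp
    qed
    then obtain n where n: "\<And>k. k \<ge> n \<Longrightarrow> w k \<in> normal_cone C (z k)"
      unfolding eventually_sequentially by blast
    have "filterlim (\<lambda>k. z (k + n)) (nhds_in (x, u) C) sequentially"
      using z by (rule filterlim_compose[OF _ filterlim_add_const_nat_at_top])
    then have "v \<in> outer_limit (nhds_in (x, u) C) (normal_cone C)"
      using n LIMSEQ_ignore_initial_segment[OF w(2), of n] unfolding outer_limit_def
      by (intro CollectI exI[of _ "\<lambda>k. z (k + n)"] exI[of _ "\<lambda>k. w (k + n)"]) auto
    then have "v \<in> normal_cone C (x, u)"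
      using outer_limit_normal_cone[OF xuC] by simp
    moreover have "G i x \<bullet> fst v = 0" if "i < m" for i
    proof (rule LIMSEQ_unique)
      have "isCont (G i) x"
        using G that W continuous_on_eq_continuous_at by blast
      then show "(\<lambda>k. G i (fst (z k)) \<bullet> fst (w k)) \<longlonglongrightarrow> G i x \<bullet> fst v"
        using fz w(2) by (intro tendsto_inner isCont_tendsto_compose[of x "G i"] tendsto_fst)
      show "(\<lambda>k. G i (fst (z k)) \<bullet> fst (w k)) \<longlonglongrightarrow> 0"
        using ev that by (intro tendsto_eventually) (auto elim!: eventually_mono)
    qed
    ultimately show ?thesis using PN[of "(x, u)"] x by simp
  qed
  then show ?thesis
    using subset_outer_limit_nhds_in[OF xuC, of "projected_normals X S"] xuC
    unfolding osc_relative_at_def C_def[symmetric] by blast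
qed

section \<open>Projectional coderivatives\<close>

text \<open>The map taking \<open>(t, - u')\<close> to \<open>(u', t)\<close> is an isometry, so it commutes with outer limits.\<close>

lemma gph_outer_limit_uminus:
  fixes L :: "'i::metric_space \<Rightarrow> ('a::euclidean_space \<times> 'b::euclidean_space) set"
  shows "graphical_outer_limit (nhds_in z C) (\<lambda>z u'. {t. (t, - u') \<in> L z}) =
    (\<lambda>u'. {t. (t, - u') \<in> outer_limit (nhds_in z C) L})"
proof -
  have "(\<exists>w\<in>gph (\<lambda>u'. {t. (t, - u') \<in> L z}). P \<and> dist w (u', t) < e) \<longleftrightarrow>
      (\<exists>w\<in>L z. P \<and> dist w (t, - u') < e)" for z P u' t e
  proof -
    have d: "dist (b, a) (u', t) = dist (a, - b) (t, - u')" for a b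
      by (simp add: dist_Pair_Pair dist_minus add.commute)
    show ?thesis
    proof
      assume "\<exists>w\<in>gph (\<lambda>u'. {t. (t, - u') \<in> L z}). P \<and> dist w (u', t) < e"
      then show "\<exists>w\<in>L z. P \<and> dist w (t, - u') < e"
        unfolding gph_def using d by fastforce
    next
      assume "\<exists>w\<in>L z. P \<and> dist w (t, - u') < e"
      then obtain a b where "(a, b) \<in> L z" "P" "dist (a, b) (t, - u') < e" by auto
      then have "(- b, a) \<in> gph (\<lambda>u'. {t. (t, - u') \<in> L z})" "dist (- b, a) (u', t) < e"
        by (auto simp: gph_def d)
      then show "\<exists>w\<in>gph (\<lambda>u'. {t. (t, - u') \<in> L z}). P \<and> dist w (u', t) < e"
        using \<open>P\<close> by blast
    qed
  qed
  then show ?thesis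
    unfolding graphical_outer_limit_def outer_limit_nhds_in_iff by simp
qed

text \<open>The graph of each mapping in the family is, up to an isometry, itself an outer limit of the
  projected normals, so idempotence applies.\<close>

lemma proj_coderivative_graphical_outer_limit:
  fixes X :: "'a::euclidean_space set" and S :: "'a \<Rightarrow> 'b::euclidean_space set"
  shows "graphical_outer_limit (nhds_in (x, u) (gph (sv_restrict S X)))
      (\<lambda>(x, u). proj_coderivative X S x u) = proj_coderivative X S x u"
proof -
  define C where "C = gph (sv_restrict S X)"
  define L where "L z = outer_limit (nhds_in z C) (projected_normals X S)" for z
  have "(\<lambda>(x, u). proj_coderivative X S x u) = (\<lambda>z u'. {t. (t, - u') \<in> L z})"
    by (auto simp: proj_coderivative_def L_def C_def fun_eq_iff)
  then have "graphical_outer_limit (nhds_in (x, u) C) (\<lambda>(x, u). proj_coderivative X S x u) =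
      (\<lambda>u'. {t. (t, - u') \<in> outer_limit (nhds_in (x, u) C) L})"
    by (simp only: gph_outer_limit_uminus)
  also have "outer_limit (nhds_in (x, u) C) L = L (x, u)"
    using outer_limit_nhds_in_idem[of C L "projected_normals X S"] by (simp add: L_def)
  also have "(\<lambda>u'. {t. (t, - u') \<in> L (x, u)}) = proj_coderivative X S x u"
    by (simp add: proj_coderivative_def L_def C_def)
  finally show ?thesis by (simp only: C_def)
qed

lemma projected_normals_slice_eq_proj_map:
  "{t. (t, - u') \<in> projected_normals X S (x, u)} =
    proj_map (tangent_cone X x) (coderivative (sv_restrict S X) x u) u'"
  by (force simp: projected_normals_def proj_map_def proj_set_def coderivative_def
      proj_point_Times_UNIV)

theorem corollary3p4:
  fixes S :: "real ^ 'n \<Rightarrow> (real ^ 'm) set"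
    and X :: "(real ^ 'n) set"
    and xbar :: "real ^ 'n"
    and ubar :: "real ^ 'm"
  assumes "closed X"
    and "xbar \<in> X"
    and "ubar \<in> S xbar"
    and "locally_closed_at (gph S) (xbar, ubar)"
    and "smooth_manifold_around X xbar"
    and "X \<subseteq> sv_dom S"
  shows "osc_relative_at
           (\<lambda>(x, u). proj_set (tangent_cone X x \<times> UNIV)
                       (normal_cone (gph (sv_restrict S X)) (x, u)))
           (gph (sv_restrict S X)) (xbar, ubar) \<and>
         proj_coderivative X S xbar ubar =
           graphical_outer_limit (nhds_in (xbar, ubar) (gph (sv_restrict S X)))
             (\<lambda>(x, u). proj_coderivative X S x u) \<and>
         graphical_outer_limit (nhds_in (xbar, ubar) (gph (sv_restrict S X)))
             (\<lambda>(x, u). proj_coderivative X S x u) =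
           proj_map (tangent_cone X xbar) (coderivative (sv_restrict S X) xbar ubar)"
proof -
  have osc: "osc_relative_at (projected_normals X S) (gph (sv_restrict S X)) (xbar, ubar)"
    using assms(5,3) by (rule osc_projected_normals)
  have "proj_coderivative X S xbar ubar =
      proj_map (tangent_cone X xbar) (coderivative (sv_restrict S X) xbar ubar)"
    using osc by (simp add: osc_relative_at_def proj_coderivative_def fun_eq_iff
        projected_normals_slice_eq_proj_map)
  with osc show ?thesis
    by (simp add: proj_coderivative_graphical_outer_limit projected_normals_def)
qed

end
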